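(* (1) If $\phi$ is submodular on $\{0,1\}^{n_x}$, then for every $i\in[n_x]$ the quantities $L_i^{\ast},U_i^{\ast},\hat\rho^{\ast}$ defined in the context have the closed forms $$L_i^{\ast}=\phi(\mathbf 0)-\phi(e_i),\qquad U_i^{\ast}=\phi(\mathbf 1-e_i)-\phi(\mathbf 1),\qquad \hat\rho^{\ast}=\max_{i\in[n_x]}\max\{-L_i^{\ast},U_i^{\ast}\}.$$ (2) If $\phi$ is supermodular on $\{0,1\}^{n_x}$, then for every $i\in[n_x]$ $$L_i^{\ast}=\phi(\mathbf 1-e_i)-\phi(\mathbf 1),\qquad U_i^{\ast}=\phi(\mathbf 0)-\phi(e_i),\qquad \hat\rho^{\ast}=\max_{i\in[n_x]}\max\{-L_i^{\ast},U_i^{\ast}\}.$$ In both cases these coefficients are sufficient to construct the penalty-based and the Lagrangian-based valid inequalities: with $\hat\rho=\hat\rho^{\ast}$, $U=U^{\ast}$, $L=L^{\ast}$, for every $z\in\{0,1\}^{n_x}$ the inequalities $$d_\ell^\top y\ge\phi(z)-\hat\rho(\mathbf 1^\top x+\mathbf 1^\top z-2x^\top z),\qquad d_\ell^\top y\ge\phi(z)-\big(U\odot(\mathbf 1-z)+L\odot z\big)^\top(x-z)$$ are valid and tight for $d_\ell^\top y\ge\phi(x)$.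
   Context: $\phi:\{0,1\}^{n_x}\to\mathbb{R}$ is the (real-valued) value function $\phi(x)=\max\{d_\ell^\top y' : y'\in Y,\ B_\ell y'\le h_\ell-A_\ell x\}$, where $Y\subseteq\mathbb{R}^{n_y}$ and $d_\ell,A_\ell,B_\ell,h_\ell$ are real data of compatible dimensions. $\phi$ is submodular if $\phi(x')+\phi(x'')\ge\phi(x'\vee x'')+\phi(x'\wedge x'')$ for all $x',x''\in\{0,1\}^{n_x}$, and supermodular if the reverse inequality holds ($\vee,\wedge$ entrywise max and min). $e_i$ is the $i$-th unit vector, $\mathbf 0,\mathbf 1$ the all-zeros and all-ones vectors, $\odot$ the entrywise product, $[n]=\{1,\dots,n\}$, $z_{-i}$ is $z$ with entry $i$ removed. $\hat\rho^{\ast}=\max\{\phi(z)-\phi(z') : z,z'\in\{0,1\}^{n_x},\|z-z'\|_2^2=1\}$; $L_i^{\ast}=\min\{\phi(z)-\phi(z')\}$ and $U_i^{\ast}=\max\{\phi(z)-\phi(z')\}$, both over $z,z'\in\{0,1\}^{n_x}$ with $z_{-i}=z'_{-i}$, $z_i=0$, $z'_i=1$. An inequality $d_\ell^\top y\ge r(x)$ is "valid and tight" for $d_\ell^\top y\ge\phi(x)$ if $r(x)\le\phi(x)$ for all $x\in\{0,1\}^{n_x}$ with equality for some $x\in\{0,1\}^{n_x}$ (here, at $x=z$). *)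

theory Defs
  imports "HOL-Analysis.Analysis"
begin

text \<open>
  Vectors are ordered componentwise, \<open>sup\<close> and \<open>inf\<close> on vectors are the entrywise maximum
  and minimum, and \<open>*\<close> is the entrywise product.
\<close>

definition binary_cube :: "(real ^ 'n) set" where
  "binary_cube = {x. \<forall>i. x $ i \<in> {0, 1}}"

definition feasible_points ::
  "(real ^ 'k) set \<Rightarrow> real ^ 'n ^ 'm \<Rightarrow> real ^ 'k ^ 'm \<Rightarrow> real ^ 'm \<Rightarrow> real ^ 'n \<Rightarrow> (real ^ 'k) set"
  where "feasible_points Y A B h x = {y \<in> Y. B *v y \<le> h - A *v x}"

text \<open>
  The maximum is over a possibly infinite set of reals, so it is rendered by \<open>Greatest\<close>; it is
  meaningful only where it is attained, i.e. under \<open>value_attained\<close>.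
\<close>

definition value_function ::
  "real ^ 'k \<Rightarrow> (real ^ 'k) set \<Rightarrow> real ^ 'n ^ 'm \<Rightarrow> real ^ 'k ^ 'm \<Rightarrow> real ^ 'm \<Rightarrow> real ^ 'n \<Rightarrow> real"
  where "value_function d Y A B h x =
    (GREATEST v. v \<in> {d \<bullet> y | y. y \<in> feasible_points Y A B h x})"

definition value_attained ::
  "real ^ 'k \<Rightarrow> (real ^ 'k) set \<Rightarrow> real ^ 'n ^ 'm \<Rightarrow> real ^ 'k ^ 'm \<Rightarrow> real ^ 'm \<Rightarrow> real ^ 'n \<Rightarrow> bool"
  where "value_attained d Y A B h x \<longleftrightarrow>
    (\<exists>y \<in> feasible_points Y A B h x. \<forall>y' \<in> feasible_points Y A B h x. d \<bullet> y' \<le> d \<bullet> y)"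

definition submodular_on_cube :: "(real ^ 'n \<Rightarrow> real) \<Rightarrow> bool" where
  "submodular_on_cube \<phi> \<longleftrightarrow>
    (\<forall>x' \<in> binary_cube. \<forall>x'' \<in> binary_cube. \<phi> x' + \<phi> x'' \<ge> \<phi> (sup x' x'') + \<phi> (inf x' x''))"

definition supermodular_on_cube :: "(real ^ 'n \<Rightarrow> real) \<Rightarrow> bool" where
  "supermodular_on_cube \<phi> \<longleftrightarrow>
    (\<forall>x' \<in> binary_cube. \<forall>x'' \<in> binary_cube. \<phi> x' + \<phi> x'' \<le> \<phi> (sup x' x'') + \<phi> (inf x' x''))"

definition rho_star :: "(real ^ 'n \<Rightarrow> real) \<Rightarrow> real" where
  "rho_star \<phi> =
    Max {\<phi> z - \<phi> z' | z z'. z \<in> binary_cube \<and> z' \<in> binary_cube \<and> (norm (z - z'))\<^sup>2 = 1}"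

definition flip_differences :: "(real ^ 'n \<Rightarrow> real) \<Rightarrow> 'n \<Rightarrow> real set" where
  "flip_differences \<phi> i =
    {\<phi> z - \<phi> z' | z z'. z \<in> binary_cube \<and> z' \<in> binary_cube \<and>
      (\<forall>j. j \<noteq> i \<longrightarrow> z $ j = z' $ j) \<and> z $ i = 0 \<and> z' $ i = 1}"

definition L_star :: "(real ^ 'n \<Rightarrow> real) \<Rightarrow> real ^ 'n" where
  "L_star \<phi> = (\<chi> i. Min (flip_differences \<phi> i))"

definition U_star :: "(real ^ 'n \<Rightarrow> real) \<Rightarrow> real ^ 'n" where
  "U_star \<phi> = (\<chi> i. Max (flip_differences \<phi> i))"

text \<open>
  \<open>r\<close> is the right-hand side, as a function of \<open>x\<close>, of an inequality bounding \<open>d \<bullet> y\<close> from below.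
\<close>

definition valid_and_tight :: "(real ^ 'n \<Rightarrow> real) \<Rightarrow> (real ^ 'n \<Rightarrow> real) \<Rightarrow> bool" where
  "valid_and_tight \<phi> r \<longleftrightarrow>
    (\<forall>x \<in> binary_cube. r x \<le> \<phi> x) \<and> (\<exists>x \<in> binary_cube. r x = \<phi> x)"

definition penalty_rhs ::
  "(real ^ 'n \<Rightarrow> real) \<Rightarrow> real \<Rightarrow> real ^ 'n \<Rightarrow> real ^ 'n \<Rightarrow> real"
  where "penalty_rhs \<phi> \<rho> z x = \<phi> z - \<rho> * (1 \<bullet> x + 1 \<bullet> z - 2 * (x \<bullet> z))"

definition lagrangian_rhs ::
  "(real ^ 'n \<Rightarrow> real) \<Rightarrow> real ^ 'n \<Rightarrow> real ^ 'n \<Rightarrow> real ^ 'n \<Rightarrow> real ^ 'n \<Rightarrow> real"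
  where "lagrangian_rhs \<phi> U L z x = \<phi> z - (U * (1 - z) + L * z) \<bullet> (x - z)"

end

theory Submission
  imports Defs
begin

text \<open>
  The formulas for \<open>L_star\<close> and \<open>U_star\<close> are diminishing (resp. increasing) marginals: the pairs
  \<open>z, e\<^sub>i\<close> and \<open>z + e\<^sub>i, 1 - e\<^sub>i\<close> have join and meet \<open>z + e\<^sub>i, 0\<close> and \<open>1, z\<close>. Everything else holds for
  an arbitrary function on the cube: a pair of points at distance 1 differs in exactly one
  coordinate, so \<open>\<phi> z - \<phi> z'\<close> is a flip difference or the negative of one; and the loss
  \<open>\<phi> z - \<phi> x\<close> is bounded by adding up the losses along a path that flips one coordinate at a time.
\<close>

section \<open>The cube and the flip differences as finite sets\<close>

lemma finite_binary_cube: "finite (binary_cube :: (real ^ 'n) set)"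
proof (rule finite_subset)
  \<comment> \<open>Cube points are indicator vectors of index sets, of which there are finitely
    many.\<close>
  show "binary_cube \<subseteq> range (\<lambda>S. \<chi> i::'n. if i \<in> S then (1::real) else 0)"
  proof
    fix x :: "real ^ 'n"
    assume "x \<in> binary_cube"
    then have "x = (\<chi> i. if i \<in> {i. x $ i = 1} then 1 else 0)"
      by (auto simp: binary_cube_def vec_eq_iff)
    then show "x \<in> range (\<lambda>S. \<chi> i. if i \<in> S then 1 else 0)"
      by blast
  qed
qed simp

lemma binary_cubeD: "x \<in> binary_cube \<Longrightarrow> x $ i = 0 \<or> x $ i = 1"
  by (auto simp: binary_cube_def)

lemma finite_flip_differences: "finite (flip_differences \<phi> i)"
proof (rule finite_subset)
  show "flip_differences \<phi> i \<subseteq> (\<lambda>(z, z'). \<phi> z - \<phi> z') ` (binary_cube \<times> binary_cube)"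
    by (auto simp: flip_differences_def)
qed (simp add: finite_binary_cube)

text \<open>This flip is one of the two extremal candidates; it also supplies the nonemptiness
  without which \<open>Min\<close> and \<open>Max\<close> are meaningless.\<close>

lemma flip_difference_bottom: "\<phi> 0 - \<phi> (axis i 1) \<in> flip_differences \<phi> i"
  unfolding flip_differences_def
  by (intro CollectI exI[of _ "0"] exI[of _ "axis i 1"]) (auto simp: binary_cube_def axis_def)

lemma flip_difference_top: "\<phi> (1 - axis i 1) - \<phi> 1 \<in> flip_differences \<phi> i"
  unfolding flip_differences_def
  by (intro CollectI exI[of _ "1 - axis i 1"] exI[of _ "1"]) (auto simp: binary_cube_def axis_def)

lemma flip_difference_bounds:
  assumes "v \<in> flip_differences \<phi> i"
  shows "L_star \<phi> $ i \<le> v" "v \<le> U_star \<phi> $ i"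
  using assms by (auto simp: L_star_def U_star_def finite_flip_differences)

lemma L_star_mem: "L_star \<phi> $ i \<in> flip_differences \<phi> i"
  and U_star_mem: "U_star \<phi> $ i \<in> flip_differences \<phi> i"
  using Min_in[OF finite_flip_differences, of \<phi> i] Max_in[OF finite_flip_differences, of \<phi> i]
    flip_difference_bottom[of \<phi> i]
  by (auto simp: L_star_def U_star_def)

lemma L_star_eqI:
  assumes "l \<in> flip_differences \<phi> i" "\<And>v. v \<in> flip_differences \<phi> i \<Longrightarrow> l \<le> v"
  shows "L_star \<phi> $ i = l"
  using assms finite_flip_differences by (auto simp: L_star_def intro!: Min_eqI)

lemma U_star_eqI:
  assumes "u \<in> flip_differences \<phi> i" "\<And>v. v \<in> flip_differences \<phi> i \<Longrightarrow> v \<le> u"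
  shows "U_star \<phi> $ i = u"
  using assms finite_flip_differences by (auto simp: U_star_def intro!: Max_eqI)

section \<open>Closed forms of the extremal flip differences\<close>

lemma flip_pair_lattice:
  assumes "z \<in> binary_cube" "z' \<in> binary_cube" "\<forall>j. j \<noteq> i \<longrightarrow> z $ j = z' $ j" "z $ i = 0" "z' $ i = 1"
  shows "sup z (axis i 1) = z'" "inf z (axis i 1) = 0"
    "sup z' (1 - axis i 1) = 1" "inf z' (1 - axis i 1) = z"
proof -
  have b: "(z $ j = 0 \<or> z $ j = 1) \<and> (z' $ j = 0 \<or> z' $ j = 1)" for j
    using assms(1,2) by (simp add: binary_cubeD)
  have
    "sup z (axis i 1) $ j = z' $ j \<and> inf z (axis i 1) $ j = 0 \<and>
     sup z' (1 - axis i 1) $ j = 1 \<and> inf z' (1 - axis i 1) $ j = z $ j" for j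
    using b[of j] assms(3-5)
    by (cases "j = i") (auto simp: axis_def sup_vec_def inf_vec_def sup_max inf_min)
  then show "sup z (axis i 1) = z'" "inf z (axis i 1) = 0"
    "sup z' (1 - axis i 1) = 1" "inf z' (1 - axis i 1) = z"
    by (simp_all add: vec_eq_iff)
qed

lemma axis_in_cube: "axis i 1 \<in> binary_cube" "1 - axis i 1 \<in> binary_cube"
  by (auto simp: binary_cube_def axis_def)

lemma submodular_flip_bounds:
  assumes "submodular_on_cube \<phi>" "v \<in> flip_differences \<phi> i"
  shows "\<phi> 0 - \<phi> (axis i 1) \<le> v" "v \<le> \<phi> (1 - axis i 1) - \<phi> 1"
proof -
  obtain z z' where v: "v = \<phi> z - \<phi> z'"
    and z: "z \<in> binary_cube" "z' \<in> binary_cube" "\<forall>j. j \<noteq> i \<longrightarrow> z $ j = z' $ j" "z $ i = 0" "z' $ i = 1"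
    using assms(2) by (auto simp: flip_differences_def)
  have sub: "\<phi> x + \<phi> y \<ge> \<phi> (sup x y) + \<phi> (inf x y)"
    if "x \<in> binary_cube" "y \<in> binary_cube" for x y
    using assms(1) that by (auto simp: submodular_on_cube_def)
  show "\<phi> 0 - \<phi> (axis i 1) \<le> v" "v \<le> \<phi> (1 - axis i 1) - \<phi> 1"
    \<comment> \<open>The first instance reads
      \<open>\<phi> z + \<phi> (axis i 1) \<ge> \<phi> z' + \<phi> 0\<close>, which is the lower
      bound; the second reads
      \<open>\<phi> z' + \<phi> (1 - axis i 1) \<ge> \<phi> 1 + \<phi> z\<close>, which is the upper
      bound.\<close>
    using sub[OF z(1) axis_in_cube(1)[of i]] sub[OF z(2) axis_in_cube(2)[of i]]
    by (simp_all add: v flip_pair_lattice[OF z])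
qed

text \<open>Negating \<open>\<phi>\<close> makes it submodular and negates every flip difference, so
  the two submodular bounds trade places.\<close>

lemma supermodular_flip_bounds:
  assumes "supermodular_on_cube \<phi>" "v \<in> flip_differences \<phi> i"
  shows "\<phi> (1 - axis i 1) - \<phi> 1 \<le> v" "v \<le> \<phi> 0 - \<phi> (axis i 1)"
proof -
  have sub: "submodular_on_cube (\<lambda>x. - \<phi> x)"
    using assms(1) unfolding supermodular_on_cube_def submodular_on_cube_def
    by (smt (verit, best))
  obtain z z' where z: "z \<in> binary_cube" "z' \<in> binary_cube" "\<forall>j. j \<noteq> i \<longrightarrow> z $ j = z' $ j"
    "z $ i = 0" "z' $ i = 1" and v: "v = \<phi> z - \<phi> z'"
    using assms(2) by (auto simp: flip_differences_def)
  then have neg: "- v \<in> flip_differences (\<lambda>x. - \<phi> x) i"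
    unfolding flip_differences_def by (intro CollectI exI[of _ z] exI[of _ z']) simp
  show "\<phi> (1 - axis i 1) - \<phi> 1 \<le> v" "v \<le> \<phi> 0 - \<phi> (axis i 1)"
    using submodular_flip_bounds[OF sub neg] by auto
qed

section \<open>Pairs at unit distance and the formula for \<open>rho_star\<close>\<close>

lemma sum_Collect_if:
  fixes f :: "'n::finite \<Rightarrow> 'b::comm_monoid_add"
  shows "sum f {i. P i} = (\<Sum>i\<in>UNIV. if P i then f i else 0)"
  using sum.inter_filter[of UNIV f P] by simp

text \<open>For binary entries each squared difference is 0 or 1, so the squared norm is the Hamming
  distance.\<close>

lemma unit_distance_iff:
  assumes "z \<in> binary_cube" "z' \<in> binary_cube"
  shows "(norm (z - z'))\<^sup>2 = 1 \<longleftrightarrow> (\<exists>i. z $ i \<noteq> z' $ i \<and> (\<forall>j. j \<noteq> i \<longrightarrow> z $ j = z' $ j))"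
proof -
  have "(z $ i - z' $ i)\<^sup>2 = (if z $ i \<noteq> z' $ i then 1 else 0)" for i
    using binary_cubeD[OF assms(1), of i] binary_cubeD[OF assms(2), of i] by auto
  then have "(norm (z - z'))\<^sup>2 = (\<Sum>i\<in>UNIV. if z $ i \<noteq> z' $ i then 1 else 0)"
    by (simp add: norm_vec_def L2_set_def sum_nonneg)
  also have "\<dots> = card {i. z $ i \<noteq> z' $ i}"
    by (simp flip: sum_Collect_if)
  finally have "(norm (z - z'))\<^sup>2 = 1 \<longleftrightarrow> card {i. z $ i \<noteq> z' $ i} = 1"
    by simp
  also have "\<dots> \<longleftrightarrow> (\<exists>i. {i. z $ i \<noteq> z' $ i} = {i})"
    by (simp add: card_1_singleton_iff)
  also have "\<dots> \<longleftrightarrow> (\<exists>i. z $ i \<noteq> z' $ i \<and> (\<forall>j. j \<noteq> i \<longrightarrow> z $ j = z' $ j))"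
    by auto
  finally show ?thesis .
qed

text \<open>The negatives arise because \<open>rho_star\<close> admits both orders of a pair, while
  a flip difference fixes the point with entry 0 as the first.\<close>

lemma unit_differences_eq:
  "{\<phi> z - \<phi> z' | z z'. z \<in> binary_cube \<and> z' \<in> binary_cube \<and> (norm (z - z'))\<^sup>2 = 1} =
    (\<Union>i. flip_differences \<phi> i \<union> uminus ` flip_differences \<phi> i)" (is "?D = ?F")
proof
  show "?D \<subseteq> ?F"
  proof
    fix v assume "v \<in> ?D"
    then obtain z z' i where v: "v = \<phi> z - \<phi> z'" and z: "z \<in> binary_cube" "z' \<in> binary_cube"
      and i: "z $ i \<noteq> z' $ i" "\<forall>j. j \<noteq> i \<longrightarrow> z $ j = z' $ j"
      using unit_distance_iff by blast
    consider "z $ i = 0" "z' $ i = 1" | "z $ i = 1" "z' $ i = 0"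
      using i(1) z by (metis binary_cubeD)
    then show "v \<in> ?F"
    proof cases
      case 1
      then have "v \<in> flip_differences \<phi> i"
        unfolding flip_differences_def using v z i(2)
        by (intro CollectI exI[of _ z] exI[of _ z']) simp
      then show ?thesis by blast
    next
      case 2
      then have "\<phi> z' - \<phi> z \<in> flip_differences \<phi> i"
        unfolding flip_differences_def using z i(2)
        by (intro CollectI exI[of _ z'] exI[of _ z]) simp
      then have "- (\<phi> z' - \<phi> z) \<in> uminus ` flip_differences \<phi> i" by (rule imageI)
      then show ?thesis using v by auto
    qed
  qed
  show "?F \<subseteq> ?D"
  proof
    fix v assume "v \<in> ?F"
    then obtain i w where w: "w \<in> flip_differences \<phi> i" "v = w \<or> v = - w" by blast
    then obtain z z' where z: "w = \<phi> z - \<phi> z'" "z \<in> binary_cube" "z' \<in> binary_cube"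
        "\<forall>j. j \<noteq> i \<longrightarrow> z $ j = z' $ j" "z $ i = 0" "z' $ i = 1"
      by (auto simp: flip_differences_def)
    then have "(norm (z - z'))\<^sup>2 = 1"
      using unit_distance_iff[OF z(2,3)] by (metis zero_neq_one)
    moreover from this have "(norm (z' - z))\<^sup>2 = 1"
      by (simp add: norm_minus_commute)
    moreover have "v = \<phi> z - \<phi> z' \<or> v = \<phi> z' - \<phi> z"
      using w(2) z(1) by auto
    ultimately show "v \<in> ?D" using z(2,3) by blast
  qed
qed

lemma rho_star_eq: "rho_star \<phi> = (MAX i. max (- (L_star \<phi> $ i)) (U_star \<phi> $ i))"
  unfolding rho_star_def unit_differences_eq
proof (rule Max_eqI)
  let ?m = "\<lambda>i. max (- (L_star \<phi> $ i)) (U_star \<phi> $ i)"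
  show "finite (\<Union>i. flip_differences \<phi> i \<union> uminus ` flip_differences \<phi> i)"
    by (simp add: finite_flip_differences)
  show "v \<le> Max (range ?m)"
    if v: "v \<in> (\<Union>i. flip_differences \<phi> i \<union> uminus ` flip_differences \<phi> i)" for v
  proof -
    obtain i where "v \<in> flip_differences \<phi> i \<union> uminus ` flip_differences \<phi> i"
      using v by blast
    then have "v \<le> ?m i"
      by (auto dest: flip_difference_bounds)
    also have "\<dots> \<le> Max (range ?m)" by (rule Max_ge) auto
    finally show ?thesis .
  qed
  have "Max (range ?m) \<in> range ?m" by (rule Max_in) auto
  then obtain i where "Max (range ?m) = ?m i" by blast
  \<comment> \<open>Both \<open>L_star\<close> and \<open>U_star\<close> are attained, so either
    value of \<open>max\<close> is an actual difference or the negative of one.\<close>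
  then show "Max (range ?m) \<in> (\<Union>i. flip_differences \<phi> i \<union> uminus ` flip_differences \<phi> i)"
    using L_star_mem[of \<phi> i] U_star_mem[of \<phi> i] by (auto simp: max_def)
qed

section \<open>Losses along a path of single flips\<close>

definition flip_on :: "'n set \<Rightarrow> real ^ 'n \<Rightarrow> real ^ 'n" where
  "flip_on S z = (\<chi> i. if i \<in> S then 1 - z $ i else z $ i)"

lemma flip_on_in_cube: "z \<in> binary_cube \<Longrightarrow> flip_on S z \<in> binary_cube"
  by (auto simp: binary_cube_def flip_on_def)

lemma single_flip_bound:
  assumes "z \<in> binary_cube"
  shows "\<phi> z - \<phi> (flip_on {i} z) \<le> (if z $ i = 0 then U_star \<phi> $ i else - (L_star \<phi> $ i))"
using binary_cubeD[OF assms, of i]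
proof
  assume 0: "z $ i = 0"
  then have "\<phi> z - \<phi> (flip_on {i} z) \<in> flip_differences \<phi> i"
    unfolding flip_differences_def using assms flip_on_in_cube[OF assms, of "{i}"]
    by (intro CollectI exI[of _ z] exI[of _ "flip_on {i} z"]) (auto simp: flip_on_def)
  then show ?thesis using 0 by (auto dest: flip_difference_bounds)
next
  assume 1: "z $ i = 1"
  \<comment> \<open>The pair is reversed here, since now the flipped point has entry 0; the loss is
    the negative of a flip difference, hence at most \<open>- L_star\<close>.\<close>
  then have "\<phi> (flip_on {i} z) - \<phi> z \<in> flip_differences \<phi> i"
    unfolding flip_differences_def using assms flip_on_in_cube[OF assms, of "{i}"]
    by (intro CollectI exI[of _ z] exI[of _ "flip_on {i} z"]) (auto simp: flip_on_def)
  then show ?thesis using 1 by (auto dest: flip_difference_bounds)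
qed

lemma flip_on_bound:
  assumes "z \<in> binary_cube" "finite S"
  shows "\<phi> z - \<phi> (flip_on S z) \<le> (\<Sum>i\<in>S. if z $ i = 0 then U_star \<phi> $ i else - (L_star \<phi> $ i))"
  using assms(2)
proof (induction S rule: finite_induct)
  case empty
  have "flip_on {} z = z" by (simp add: flip_on_def vec_eq_iff)
  then show ?case by simp
next
  case (insert i S)
  \<comment> \<open>As \<open>i\<close> is not in \<open>S\<close>, the earlier flips leave entry
    \<open>i\<close> alone, so the weight of the new flip depends on the starting point
    \<open>z\<close> and not on the intermediate point.\<close>
  have "flip_on (insert i S) z = flip_on {i} (flip_on S z)" "flip_on S z $ i = z $ i"
    using insert.hyps by (auto simp: flip_on_def vec_eq_iff)
  then show ?case
    using insert single_flip_bound[OF flip_on_in_cube[OF assms(1)], of \<phi> S i] by simp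
qed

text \<open>Flipping exactly the entries where \<open>x\<close> and \<open>z\<close> disagree turns
  \<open>z\<close> into \<open>x\<close>.\<close>

lemma cube_difference_bound:
  assumes "z \<in> binary_cube" "x \<in> binary_cube"
  shows "\<phi> z - \<phi> x \<le>
    (\<Sum>i | x $ i \<noteq> z $ i. if z $ i = 0 then U_star \<phi> $ i else - (L_star \<phi> $ i))"
proof -
  have "flip_on {i. x $ i \<noteq> z $ i} z $ i = x $ i" for i
    using binary_cubeD[OF assms(1), of i] binary_cubeD[OF assms(2), of i]
    by (auto simp: flip_on_def)
  then have "flip_on {i. x $ i \<noteq> z $ i} z = x"
    by (simp add: vec_eq_iff)
  then show ?thesis
    using flip_on_bound[OF assms(1), of "{i. x $ i \<noteq> z $ i}" \<phi>] by simp
qed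

section \<open>Validity and tightness of the two inequalities\<close>

lemma lagrangian_rhs_eq:
  assumes "z \<in> binary_cube" "x \<in> binary_cube"
  shows "lagrangian_rhs \<phi> U L z x =
    \<phi> z - (\<Sum>i | x $ i \<noteq> z $ i. if z $ i = 0 then U $ i else - (L $ i))"
proof -
  \<comment> \<open>Where \<open>z\<close> has entry 0 the coefficient is \<open>U\<close> and a
    disagreement is a step of +1; where it has entry 1 the coefficient is \<open>L\<close> and the
    step is -1. This matches the weights of \<open>cube_difference_bound\<close>.\<close>
  have "(U $ i * (1 - z $ i) + L $ i * z $ i) * (x $ i - z $ i) =
      (if x $ i \<noteq> z $ i then if z $ i = 0 then U $ i else - (L $ i) else 0)" for i
    using binary_cubeD[OF assms(1), of i] binary_cubeD[OF assms(2), of i] by auto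
  then show ?thesis
    by (simp add: lagrangian_rhs_def inner_vec_def sum_Collect_if)
qed

lemma penalty_rhs_eq:
  assumes "z \<in> binary_cube" "x \<in> binary_cube"
  shows "penalty_rhs \<phi> \<rho> z x = \<phi> z - (\<Sum>i | x $ i \<noteq> z $ i. \<rho>)"
proof -
  \<comment> \<open>On binary entries \<open>x + z - 2 x z\<close> is the indicator of disagreement,
    so the penalty is \<open>\<rho>\<close> times the Hamming distance.\<close>
  have "\<rho> * (x $ i + z $ i - 2 * (x $ i * z $ i)) = (if x $ i \<noteq> z $ i then \<rho> else 0)" for i
    using binary_cubeD[OF assms(1), of i] binary_cubeD[OF assms(2), of i] by auto
  then have "(\<Sum>i\<in>UNIV. \<rho> * (x $ i + z $ i - 2 * (x $ i * z $ i))) = (\<Sum>i | x $ i \<noteq> z $ i. \<rho>)"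
    by (simp only: sum_Collect_if)
  then show ?thesis
    by (simp add: penalty_rhs_def inner_vec_def sum_distrib_left sum.distrib sum_subtractf
        algebra_simps)
qed

lemma flip_weight_le_rho_star: "U_star \<phi> $ i \<le> rho_star \<phi>" "- (L_star \<phi> $ i) \<le> rho_star \<phi>"
proof -
  have "max (- (L_star \<phi> $ i)) (U_star \<phi> $ i) \<le> rho_star \<phi>"
    unfolding rho_star_eq by (rule Max_ge) auto
  then show "U_star \<phi> $ i \<le> rho_star \<phi>" "- (L_star \<phi> $ i) \<le> rho_star \<phi>" by auto
qed

lemma lagrangian_rhs_valid:
  assumes "z \<in> binary_cube"
  shows "valid_and_tight \<phi> (lagrangian_rhs \<phi> (U_star \<phi>) (L_star \<phi>) z)"
  unfolding valid_and_tight_def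
proof
  show "\<forall>x\<in>binary_cube. lagrangian_rhs \<phi> (U_star \<phi>) (L_star \<phi>) z x \<le> \<phi> x"
    using cube_difference_bound[OF assms, of _ \<phi>]
    by (auto simp: lagrangian_rhs_eq[OF assms] algebra_simps)
  show "\<exists>x\<in>binary_cube. lagrangian_rhs \<phi> (U_star \<phi>) (L_star \<phi>) z x = \<phi> x"
    \<comment> \<open>At \<open>x = z\<close> no entry disagrees and the subtracted sum is
      empty.\<close>
    using assms lagrangian_rhs_eq[OF assms assms] by (intro bexI[of _ z]) simp_all
qed

lemma penalty_rhs_valid:
  assumes "z \<in> binary_cube"
  shows "valid_and_tight \<phi> (penalty_rhs \<phi> (rho_star \<phi>) z)"
  unfolding valid_and_tight_def
proof
  show "\<forall>x\<in>binary_cube. penalty_rhs \<phi> (rho_star \<phi>) z x \<le> \<phi> x"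
  proof
    fix x :: "real ^ 'a" assume x: "x \<in> binary_cube"
    \<comment> \<open>Replacing every flip weight by the common bound \<open>rho_star\<close> only
      weakens the Lagrangian bound.\<close>
    have "(\<Sum>i | x $ i \<noteq> z $ i. if z $ i = 0 then U_star \<phi> $ i else - (L_star \<phi> $ i))
        \<le> (\<Sum>i | x $ i \<noteq> z $ i. rho_star \<phi>)"
      by (rule sum_mono) (simp add: flip_weight_le_rho_star)
    with cube_difference_bound[OF assms x, of \<phi>]
    show "penalty_rhs \<phi> (rho_star \<phi>) z x \<le> \<phi> x"
      unfolding penalty_rhs_eq[OF assms x] by linarith
  qed
  show "\<exists>x\<in>binary_cube. penalty_rhs \<phi> (rho_star \<phi>) z x = \<phi> x"
    using assms penalty_rhs_eq[OF assms assms] by (intro bexI[of _ z]) simp_all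
qed

theorem proposition6:
  fixes d :: "real ^ 'k" and Y :: "(real ^ 'k) set"
    and A :: "real ^ 'n ^ 'm" and B :: "real ^ 'k ^ 'm" and h :: "real ^ 'm"
    and \<phi> :: "real ^ 'n \<Rightarrow> real"
  assumes phi: "\<phi> = value_function d Y A B h"
    and real_valued: "\<forall>x \<in> binary_cube. value_attained d Y A B h x"
  shows
    "(submodular_on_cube \<phi> \<longrightarrow>
        (\<forall>i. L_star \<phi> $ i = \<phi> 0 - \<phi> (axis i 1) \<and>
             U_star \<phi> $ i = \<phi> (1 - axis i 1) - \<phi> 1) \<and>
        rho_star \<phi> = (MAX i. max (- (L_star \<phi> $ i)) (U_star \<phi> $ i))) \<and>
     (supermodular_on_cube \<phi> \<longrightarrow>
        (\<forall>i. L_star \<phi> $ i = \<phi> (1 - axis i 1) - \<phi> 1 \<and>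
             U_star \<phi> $ i = \<phi> 0 - \<phi> (axis i 1)) \<and>
        rho_star \<phi> = (MAX i. max (- (L_star \<phi> $ i)) (U_star \<phi> $ i))) \<and>
     (submodular_on_cube \<phi> \<or> supermodular_on_cube \<phi> \<longrightarrow>
        (\<forall>z \<in> binary_cube.
           valid_and_tight \<phi> (penalty_rhs \<phi> (rho_star \<phi>) z) \<and>
           penalty_rhs \<phi> (rho_star \<phi>) z z = \<phi> z \<and>
           valid_and_tight \<phi> (lagrangian_rhs \<phi> (U_star \<phi>) (L_star \<phi>) z) \<and>
           lagrangian_rhs \<phi> (U_star \<phi>) (L_star \<phi>) z z = \<phi> z))"
proof (intro conjI impI allI ballI)
  fix i
  assume sub: "submodular_on_cube \<phi>"
  show "L_star \<phi> $ i = \<phi> 0 - \<phi> (axis i 1)"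
    by (intro L_star_eqI flip_difference_bottom submodular_flip_bounds(1)[OF sub])
  show "U_star \<phi> $ i = \<phi> (1 - axis i 1) - \<phi> 1"
    by (intro U_star_eqI flip_difference_top submodular_flip_bounds(2)[OF sub])
next
  fix i
  assume sup: "supermodular_on_cube \<phi>"
  show "L_star \<phi> $ i = \<phi> (1 - axis i 1) - \<phi> 1"
    by (intro L_star_eqI flip_difference_top supermodular_flip_bounds(1)[OF sup])
  show "U_star \<phi> $ i = \<phi> 0 - \<phi> (axis i 1)"
    by (intro U_star_eqI flip_difference_bottom supermodular_flip_bounds(2)[OF sup])
next
  fix z :: "real ^ 'n"
  assume z: "z \<in> binary_cube"
  show "valid_and_tight \<phi> (penalty_rhs \<phi> (rho_star \<phi>) z)"
    using z by (rule penalty_rhs_valid)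
  show "penalty_rhs \<phi> (rho_star \<phi>) z z = \<phi> z"
    using penalty_rhs_eq[OF z z] by simp
  show "valid_and_tight \<phi> (lagrangian_rhs \<phi> (U_star \<phi>) (L_star \<phi>) z)"
    using z by (rule lagrangian_rhs_valid)
  show "lagrangian_rhs \<phi> (U_star \<phi>) (L_star \<phi>) z z = \<phi> z"
    using lagrangian_rhs_eq[OF z z] by simp
\<comment> \<open>What remains is the formula for \<open>rho_star\<close>, once for each of the two
  cases.\<close>
qed (rule rho_star_eq)+

end
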